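(* Any data structure of size $\tilde{\mathcal{O}}(n)$ for maintaining a longest common substring of a dynamic string $S$ (undergoing single-letter substitutions) and a static string $T$, each of length at most $n$, requires $\Omega(\log n/\log\log n)$ time per update operation.
   Context: $\tilde{\mathcal{O}}(n)$ means $n\cdot\log^{\mathcal{O}(1)} n$. A longest common substring of two strings is a longest string occurring as a substring of both. The lower bound is for data structures in the cell-probe/word-RAM model with words of $\Theta(\log n)$ bits. *)

theory Defs
  imports Complex_Main
begin

text \<open>Cell-probe model. Memory is a map from addresses to natural numbers; a structure
  with s cells of w bits only ever accesses address (i mod s) and only ever sees/stores
  values modulo 2^w. An operation is an adaptive decision tree of cell probes.\<close>

datatype 'a probe_tree =
    Leaf 'a
  | Read nat "nat \<Rightarrow> 'a probe_tree"
  | Write nat nat "'a probe_tree"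

type_synonym mem = "nat \<Rightarrow> nat"

primrec exec :: "nat \<Rightarrow> nat \<Rightarrow> 'a probe_tree \<Rightarrow> mem \<Rightarrow> 'a \<times> mem \<times> nat" where
  "exec s w (Leaf a) m = (a, m, 0)"
| "exec s w (Read i f) m =
     (case exec s w (f (m (i mod s) mod 2 ^ w)) m of (a, m', c) \<Rightarrow> (a, m', Suc c))"
| "exec s w (Write i v t) m =
     (case exec s w t (m(i mod s := v mod 2 ^ w)) of (a, m', c) \<Rightarrow> (a, m', Suc c))"

definition common_substring :: "nat list \<Rightarrow> nat list \<Rightarrow> nat \<times> nat \<times> nat \<Rightarrow> bool" where
  "common_substring S T x = (case x of (i, j, l) \<Rightarrow>
     i + l \<le> length S \<and> j + l \<le> length T \<and> take l (drop i S) = take l (drop j T))"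

definition is_lcs :: "nat list \<Rightarrow> nat list \<Rightarrow> nat \<times> nat \<times> nat \<Rightarrow> bool" where
  "is_lcs S T x = (common_substring S T x \<and>
     (\<forall>i' j' l'. common_substring S T (i', j', l') \<longrightarrow> l' \<le> snd (snd x)))"

definition str_n :: "nat \<Rightarrow> nat list \<Rightarrow> bool" where
  "str_n n S = (length S \<le> n \<and> set S \<subseteq> {0..<n})"

inductive reach :: "nat \<Rightarrow> nat \<Rightarrow> nat \<Rightarrow> (nat list \<Rightarrow> nat list \<Rightarrow> mem)
     \<Rightarrow> (nat \<Rightarrow> nat \<Rightarrow> (nat \<times> nat \<times> nat) probe_tree) \<Rightarrow> nat list \<Rightarrow> nat list \<times> mem \<Rightarrow> bool"
  for n s w init upd T where
  start: "str_n n S0 \<Longrightarrow> reach n s w init upd T (S0, init S0 T)"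
| step: "reach n s w init upd T (S, m) \<Longrightarrow> j < length S \<Longrightarrow> a < n \<Longrightarrow>
     exec s w (upd j a) m = (ans, m', c) \<Longrightarrow> reach n s w init upd T (S[j := a], m')"

text \<open>A (deterministic, cell-probe) data structure with s cells of w bits, arbitrary
  preprocessing init, and update procedure upd j a (substitute S[j] := a) which outputs
  a longest common substring of the updated S and the static T, correctly and with at
  most t cell probes (worst case) for every update sequence and all inputs S, T of
  length at most n over alphabet {0..<n}.\<close>
definition lcs_ds :: "nat \<Rightarrow> nat \<Rightarrow> nat \<Rightarrow> (nat list \<Rightarrow> nat list \<Rightarrow> mem)
     \<Rightarrow> (nat \<Rightarrow> nat \<Rightarrow> (nat \<times> nat \<times> nat) probe_tree) \<Rightarrow> nat \<Rightarrow> bool" where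
  "lcs_ds n s w init upd t = (0 < s \<and>
     (\<forall>T S m j a. str_n n T \<longrightarrow> reach n s w init upd T (S, m) \<longrightarrow> j < length S \<longrightarrow> a < n \<longrightarrow>
        (case exec s w (upd j a) m of (ans, m', c) \<Rightarrow> is_lcs (S[j := a]) T ans \<and> c \<le> t)))"

end

theory Submission
  imports Defs "HOL-Combinatorics.Permutations" "HOL-Real_Asymp.Real_Asymp"
begin

text \<open>
  A single update after preprocessing is already hard. The static string lists the blocked edges of
  \<open>A\<close> butterfly networks of degree \<open>2 * b\<close> and depth \<open>d\<close>, and the dynamic string contains a block
  \<open>x $ y\<close> for every source \<open>x\<close> and sink \<open>y\<close>. The path from \<open>x\<close> to \<open>y\<close> crosses level \<open>k\<close> along the edge
  determined by the digits \<open>k, \<dots>\<close> of \<open>x\<close> and the digits \<open>0, \<dots>, k\<close> of \<open>y\<close>. Hence replacing \<open>$\<close> by the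
  letter of butterfly \<open>a\<close> produces a common substring of length \<open>d + 2\<close> iff the path is blocked in \<open>a\<close>.

  The blocked edges are encoded by a set \<open>D\<close> in such a way that for each \<open>D\<close> and each routing (a
  permutation of the \<open>b\<close> digit pairs for every switch) there are unblocked paths that follow the routing
  and together visit every node of every level. If \<open>t\<close> were small, the queries for all these paths would
  probe a set of few cells, and there are few such sets. So some \<open>D\<close> has very many routings with
  one common cell set, and very many other \<open>D'\<close> show the same contents there. Each of these \<open>D'\<close>
  agrees with \<open>D\<close> on all edges used by the routings. Many routings use many edges, which leaves too little
  freedom for the sets \<open>D'\<close>.
\<close>

subsection \<open>Probed cells\<close>

primrec probes :: "nat \<Rightarrow> nat \<Rightarrow> 'a probe_tree \<Rightarrow> mem \<Rightarrow> nat set" where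
  "probes s w (Leaf a) m = {}"
| "probes s w (Read i f) m = insert (i mod s) (probes s w (f (m (i mod s) mod 2 ^ w)) m)"
| "probes s w (Write i v u) m = insert (i mod s) (probes s w u (m(i mod s := v mod 2 ^ w)))"

lemma finite_probes: "finite (probes s w u m)"
  by (induction u arbitrary: m) auto

lemma card_probes_le: "card (probes s w u m) \<le> snd (snd (exec s w u m))"
proof (induction u arbitrary: m)
  case (Read i f)
  show ?case
    using Read[of "f (m (i mod s) mod 2 ^ w)" m]
    by (auto simp: card_insert_if finite_probes split: prod.splits)
next
  case (Write i v u)
  show ?case
    using Write[of "m(i mod s := v mod 2 ^ w)"]
    by (auto simp: card_insert_if finite_probes simp del: fun_upd_apply split: prod.splits)
qed simp

lemma probes_subset: "0 < s \<Longrightarrow> probes s w u m \<subseteq> {..<s}"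
  by (induction u arbitrary: m) auto

text \<open>The run branches only on values it reads, at addresses in \<open>probes\<close>; a write
  alters both memories alike, so agreement modulo \<open>2 ^ w\<close> persists.\<close>

lemma exec_agree_on_probes:
  assumes "\<And>i. i \<in> probes s w u m \<Longrightarrow> m i mod 2 ^ w = m' i mod 2 ^ w"
  shows "fst (exec s w u m') = fst (exec s w u m)"
  using assms
proof (induction u arbitrary: m m')
  case (Read i f)
  have "m' (i mod s) mod 2 ^ w = m (i mod s) mod 2 ^ w"
    using Read.prems[of "i mod s"] by simp
  moreover have "fst (exec s w (f (m (i mod s) mod 2 ^ w)) m')
      = fst (exec s w (f (m (i mod s) mod 2 ^ w)) m)"
    using Read.prems by (intro Read.IH) auto
  ultimately show ?case
    by (auto split: prod.splits)
next
  case (Write i v u)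
  have "fst (exec s w u (m'(i mod s := v mod 2 ^ w))) = fst (exec s w u (m(i mod s := v mod 2 ^ w)))"
  proof (rule Write.IH)
    fix a assume "a \<in> probes s w u (m(i mod s := v mod 2 ^ w))"
    then have "m a mod 2 ^ w = m' a mod 2 ^ w"
      using Write.prems[of a] by (simp del: fun_upd_apply)
    then show "(m(i mod s := v mod 2 ^ w)) a mod 2 ^ w = (m'(i mod s := v mod 2 ^ w)) a mod 2 ^ w"
      by simp
  qed
  then show ?case
    by (auto split: prod.splits)
qed simp

subsection \<open>Counting\<close>

lemma pigeonhole_card:
  assumes "finite X" "finite Y" "Y \<noteq> {}" "f ` X \<subseteq> Y"
  shows "\<exists>c\<in>Y. card X \<le> card Y * card {x \<in> X. f x = c}"
proof (rule ccontr)
  assume "\<not> ?thesis"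
  then have *: "\<And>c. c \<in> Y \<Longrightarrow> card Y * card {x \<in> X. f x = c} < card X"
    by (meson not_le)
  have "card X = (\<Sum>c\<in>Y. card {x \<in> X. f x = c})"
    using sum.group[OF assms(1,2,4), of "\<lambda>_. 1::nat"] by simp
  then have "card Y * card X = (\<Sum>c\<in>Y. card Y * card {x \<in> X. f x = c})"
    by (simp add: sum_distrib_left)
  also have "\<dots> < (\<Sum>c\<in>Y. card X)"
    using * assms by (intro sum_strict_mono) auto
  finally show False by simp
qed

text \<open>Give \<open>C\<close> the weight \<open>q ^ r * (1 / q) ^ card C\<close>, which is at
  least 1 when \<open>card C \<le> r\<close>; over all subsets the sum of
  \<open>(1 / q) ^ card C\<close> factors into \<open>(1 + 1 / q) ^ s\<close>.\<close>

lemma card_small_subsets_le: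
  fixes q :: real
  assumes "q \<ge> 1"
  shows "real (card {C. C \<subseteq> {..<s} \<and> card C \<le> r}) \<le> exp (real s / q) * q ^ r"
proof -
  let ?F = "{C. C \<subseteq> {..<s} \<and> card C \<le> r}"
  have "real (card ?F) = (\<Sum>C\<in>?F. 1)" by simp
  also have "\<dots> \<le> (\<Sum>C\<in>?F. q ^ r * (1 / q) ^ card C)"
  proof (intro sum_mono)
    fix C assume "C \<in> ?F"
    then have "q ^ card C \<le> q ^ r"
      using assms by (intro power_increasing) auto
    then show "1 \<le> q ^ r * (1 / q) ^ card C"
      using assms by (simp add: power_divide field_simps)
  qed
  also have "\<dots> \<le> (\<Sum>C\<in>Pow {..<s}. q ^ r * (1 / q) ^ card C)"
    using assms by (intro sum_mono2) auto
  also have "\<dots> = q ^ r * (\<Sum>C\<in>Pow {..<s}. (1 / q) ^ card C)"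
    by (simp add: sum_distrib_left)
  also have "(\<Sum>C\<in>Pow {..<s}. (1 / q) ^ card C) = (1 + 1 / q) ^ s"
    using prod_add[of "{..<s}" "\<lambda>_. 1 / q" "\<lambda>_. 1"]
    by (simp add: add.commute)
  also have "(1 + 1 / q) ^ s \<le> exp (1 / q) ^ s"
    using assms by (intro power_mono exp_ge_add_one_self) auto
  also have "exp (1 / q) ^ s = exp (real s / q)"
    by (simp flip: exp_of_nat_mult)
  finally show ?thesis using assms by (simp add: mult.commute mult_left_mono)
qed

text \<open>A weak Stirling bound; the induction step rests on
  \<open>(1 + 1 / b) ^ b \<le> exp 1\<close>.\<close>

lemma power_le_fact_exp: "real b ^ b \<le> fact b * exp (real b)"
proof (induction b)
  case (Suc b)
  show ?case
  proof (cases "b = 0")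
    case False
    have "real (Suc b) ^ b = real b ^ b * (1 + 1 / real b) ^ b"
      using False by (simp add: field_simps flip: power_mult_distrib)
    also have "\<dots> \<le> real b ^ b * exp (1 / real b) ^ b"
      by (intro mult_left_mono power_mono exp_ge_add_one_self) auto
    also have "exp (1 / real b) ^ b = exp 1"
      using False by (simp flip: exp_of_nat_mult)
    also have "real b ^ b * exp 1 \<le> (fact b * exp (real b)) * exp 1"
      using Suc by (intro mult_right_mono) auto
    finally have "real (Suc b) * real (Suc b) ^ b \<le> real (Suc b) * (fact b * exp (real b) * exp 1)"
      by (intro mult_left_mono) auto
    then show ?thesis
      by (simp add: exp_add mult_ac)
  qed (use exp_ge_add_one_self[of 1] in simp)
qed simp

text \<open>Each factor obeys the tangent-line bound \<open>u \<le> y * exp (u / y - 1)\<close>, so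
  a small sum of the factor sizes forces a small product. The parameter \<open>y\<close> is
  free.\<close>

lemma card_PiE_le_exp:
  fixes y :: real
  assumes "finite J" "\<And>\<iota>. \<iota> \<in> J \<Longrightarrow> finite (N \<iota>)" "0 < y"
  shows "real (card (PiE J N)) \<le> y ^ card J * exp ((\<Sum>\<iota>\<in>J. real (card (N \<iota>))) / y - real (card J))"
proof -
  have "real (card (PiE J N)) = (\<Prod>\<iota>\<in>J. real (card (N \<iota>)))"
    using assms by (simp add: card_PiE)
  also have "\<dots> \<le> (\<Prod>\<iota>\<in>J. y * exp (real (card (N \<iota>)) / y - 1))"
  proof (intro prod_mono conjI)
    fix \<iota>
    have "real (card (N \<iota>)) / y \<le> exp (real (card (N \<iota>)) / y - 1)"
      using exp_ge_add_one_self[of "real (card (N \<iota>)) / y - 1"] by simp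
    then show "real (card (N \<iota>)) \<le> y * exp (real (card (N \<iota>)) / y - 1)"
      using assms(3) by (simp add: field_simps)
  qed auto
  also have "\<dots> = y ^ card J * exp (\<Sum>\<iota>\<in>J. real (card (N \<iota>)) / y - 1)"
    using assms(1) by (simp add: prod.distrib exp_sum)
  also have "(\<Sum>\<iota>\<in>J. real (card (N \<iota>)) / y - 1) = (\<Sum>\<iota>\<in>J. real (card (N \<iota>))) / y - real (card J)"
    by (simp add: sum_subtractf sum_divide_distrib)
  finally show ?thesis .
qed

subsection \<open>Common substrings\<close>

text \<open>Terminators stand at distance \<open>l + 1\<close>, so a window of length
  \<open>l\<close> that avoids them must coincide with a block.\<close>

lemma factor_of_terminated_concat:
  assumes "concat (map (\<lambda>e. e @ [h]) es) = t1 @ v @ t2" "length v = l" "0 < l" "h \<notin> set v"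
    and "\<And>e. e \<in> set es \<Longrightarrow> length e = l"
  shows "v \<in> set es"
  using assms(1,5)
proof (induction es arbitrary: t1)
  case Nil
  then show ?case using assms(2,3) by simp
next
  case (Cons e es)
  let ?C = "concat (map (\<lambda>e. e @ [h]) es)"
  have eq: "e @ [h] @ ?C = t1 @ v @ t2" and len: "length e = l"
    using Cons.prems by auto
  consider "t1 = []" | "0 < length t1" "length t1 \<le> l" | "l < length t1" by fastforce
  then show ?case
  proof cases
    case 1
    then have "e = v"
      using eq len assms(2) by (simp add: append_eq_append_conv)
    then show ?thesis by simp
  next
    case 2
    have "h = (e @ [h] @ ?C) ! l"
      using len by (simp add: nth_append)
    also have "\<dots> = v ! (l - length t1)"
      unfolding eq using 2 assms(2,3) by (auto simp: nth_append)
    also have "\<dots> \<in> set v"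
      using 2 assms(2,3) by (intro nth_mem) (simp add: diff_less)
    finally show ?thesis using assms(4) by simp
  next
    case 3
    then have "drop (l + 1) (e @ [h] @ ?C) = drop (l + 1) t1 @ v @ t2"
      unfolding eq by simp
    then have "?C = drop (l + 1) t1 @ v @ t2"
      using len by simp
    then have "v \<in> set es"
      using Cons.prems(2) by (intro Cons.IH) auto
    then show ?thesis by simp
  qed
qed

lemma common_substring_iff:
  "common_substring S T (i, j, l) \<longleftrightarrow>
    (\<exists>v p1 p2 t1 t2. S = p1 @ v @ p2 \<and> T = t1 @ v @ t2 \<and> length p1 = i \<and> length t1 = j \<and> length v = l)"
  (is "?L \<longleftrightarrow> ?R")
proof
  assume L: ?L
  let ?v = "take l (drop i S)"
  have "S = take i S @ ?v @ drop (i + l) S" "T = take j T @ take l (drop j T) @ drop (j + l) T"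
    by (metis append_take_drop_id drop_drop add.commute)+
  then have "S = take i S @ ?v @ drop (i + l) S" "T = take j T @ ?v @ drop (j + l) T"
    using L by (auto simp: common_substring_def)
  moreover have "length (take i S) = i" "length (take j T) = j" "length ?v = l"
    using L by (auto simp: common_substring_def)
  ultimately show ?R by blast
qed (auto simp: common_substring_def)

text \<open>Prefixes of a common substring are common substrings, so the reported length alone
  decides whether one of length \<open>l\<close> exists.\<close>

lemma lcs_length_ge_iff:
  assumes "is_lcs S T ans"
  shows "l \<le> snd (snd ans) \<longleftrightarrow> (\<exists>v p1 p2 t1 t2. S = p1 @ v @ p2 \<and> T = t1 @ v @ t2 \<and> length v = l)"
    (is "?L \<longleftrightarrow> ?R")
proof
  assume L: ?L
  obtain i j l' where ans: "ans = (i, j, l')" by (cases ans)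
  have "common_substring S T (i, j, l')"
    using assms by (simp add: is_lcs_def ans)
  then have "common_substring S T (i, j, l)"
    using L by (auto simp: common_substring_def ans dest: arg_cong[where f = "take l"])
  then show ?R
    unfolding common_substring_iff by blast
next
  assume ?R
  then show ?L
    using assms common_substring_iff[of S T _ _ l] by (metis is_lcs_def)
qed

lemma set_factor_subset: "w = p @ v @ q \<Longrightarrow> set v \<subseteq> set w"
  by auto

lemma nth_other_in_set:
  assumes "(u @ c # v) ! i = e" "i < length (u @ c # v)" "i \<noteq> length u"
  shows "e \<in> set u \<union> set v"
proof (cases "i < length u")
  case True
  then show ?thesis
    using assms(1) by (metis UnI1 nth_append nth_mem)
next
  case False
  then have "e = v ! (i - length u - 1)" "i - length u - 1 < length v"
    using assms by (auto simp: nth_append nth_Cons')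
  then show ?thesis by simp
qed

subsection \<open>Routing in butterflies\<close>

locale butterfly =
  fixes A d b :: nat
begin

text \<open>A digit \<open>q < 2 * b\<close> stands for the pair \<open>(q div 2, q mod 2)\<close>. An edge of level \<open>k\<close> replaces digit \<open>k\<close>,
  and the remaining digits \<open>g\<close> name its switch \<open>(a, k, g)\<close>. For each switch and each \<open>i, j < b\<close> the data
  \<open>D\<close> select one of the two perfect matchings between the digits over \<open>i\<close> and the digits over \<open>j\<close>;
  the edges of the other matching are blocked. So every \<open>D\<close> is compatible with every routing.\<close>

definition V :: "nat list set" where
  "V = {x. set x \<subseteq> {..<2 * b} \<and> length x = d}"

definition switches :: "(nat \<times> nat \<times> nat list) set" where
  "switches = {..<A} \<times> {..<d} \<times> {g. set g \<subseteq> {..<2 * b} \<and> length g = d - 1}"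

definition slots :: "((nat \<times> nat \<times> nat list) \<times> nat \<times> nat) set" where
  "slots = switches \<times> {..<b} \<times> {..<b}"

definition routings :: "(nat \<times> nat \<times> nat list \<Rightarrow> nat \<Rightarrow> nat) set" where
  "routings = (\<Pi>\<^sub>E \<iota>\<in>switches. {p. p permutes {..<b}})"

text \<open>The path from \<open>x\<close> to \<open>y\<close> enters level \<open>k\<close> at
  \<open>take k y @ drop k x\<close>, so its switch needs no intermediate nodes. Of the digit pairs
  over \<open>(i, j)\<close>, those with odd sum form one matching and those with even sum the
  other; membership in \<open>D\<close> selects the odd one.\<close>

definition clear :: "((nat \<times> nat \<times> nat list) \<times> nat \<times> nat) set \<Rightarrow> nat \<Rightarrow> nat list \<Rightarrow> nat list \<Rightarrow> bool" where
  "clear D a x y \<longleftrightarrow> (\<forall>k<d. odd (x ! k + y ! k) =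
     (((a, k, take k y @ drop (Suc k) x), x ! k div 2, y ! k div 2) \<in> D))"

text \<open>The routing chooses the upper part \<open>j\<close> of the new digit; the low bit is
  kept or flipped so that the edge is unblocked in \<open>D\<close>.\<close>

definition step :: "((nat \<times> nat \<times> nat list) \<times> nat \<times> nat) set \<Rightarrow> (nat \<times> nat \<times> nat list \<Rightarrow> nat \<Rightarrow> nat)
    \<Rightarrow> nat \<Rightarrow> nat \<Rightarrow> nat list \<Rightarrow> nat list" where
  "step D p a k z = (let \<iota> = (a, k, take k z @ drop (Suc k) z); i = z ! k div 2; j = p \<iota> i
     in z[k := 2 * j + (z ! k + of_bool ((\<iota>, i, j) \<in> D)) mod 2])"

primrec node where
  "node D p a 0 x = x"
| "node D p a (Suc k) x = step D p a k (node D p a k x)"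

definition dest where "dest D p a x = node D p a d x"

lemma finite_V: "finite V" and card_V: "card V = (2 * b) ^ d"
  unfolding V_def by (simp_all add: finite_lists_length_eq card_lists_length_eq)

lemma finite_switches: "finite switches"
  unfolding switches_def by (auto simp: finite_lists_length_eq)

lemma card_switches: "card switches = A * d * (2 * b) ^ (d - 1)"
  unfolding switches_def by (simp add: card_cartesian_product card_lists_length_eq)

lemma finite_slots: "finite slots"
  unfolding slots_def by (simp add: finite_switches)

lemma finite_routings: "finite routings"
  unfolding routings_def by (intro finite_PiE finite_switches finite_permutations) auto

lemma card_routings: "card routings = fact b ^ card switches"
  unfolding routings_def by (simp add: card_PiE finite_switches card_permutations[of _ b])

lemma switch_of_node:
  assumes "a < A" "k < d" "z \<in> V"
  shows "(a, k, take k z @ drop (Suc k) z) \<in> switches"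
  using assms set_take_subset[of k z] set_drop_subset[of "Suc k" z] unfolding switches_def V_def by auto

lemma routing_permutes: "p \<in> routings \<Longrightarrow> \<iota> \<in> switches \<Longrightarrow> p \<iota> permutes {..<b}"
  using PiE_mem[of p switches "\<lambda>_. {p. p permutes {..<b}}" \<iota>] unfolding routings_def by simp

lemma digit_div: "z \<in> V \<Longrightarrow> k < d \<Longrightarrow> z ! k div 2 < b"
  unfolding V_def using nth_mem[of k z] by fastforce

lemma step_in_V:
  assumes "p \<in> routings" "a < A" "k < d" "z \<in> V"
  shows "step D p a k z \<in> V"
proof -
  define \<iota> where "\<iota> = (a, k, take k z @ drop (Suc k) z)"
  have "p \<iota> (z ! k div 2) < b"
    using permutes_in_image[OF routing_permutes[OF assms(1) switch_of_node[OF assms(2-4)]],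
        of "z ! k div 2"] digit_div[OF assms(4,3)] by (simp add: \<iota>_def)
  then have "2 * p \<iota> (z ! k div 2) + v mod 2 < 2 * b" for v
    by linarith
  then show ?thesis
    using assms(4) set_update_subset_insert[of z k]
    unfolding step_def Let_def V_def \<iota>_def by fastforce
qed

lemma step_other_digits:
  "take k (step D p a k z) @ drop (Suc k) (step D p a k z) = take k z @ drop (Suc k) z"
  unfolding step_def Let_def by simp

text \<open>The upper part of the old digit is recovered by injectivity of the permutation; this
  fixes the flip bit, and with it the old low bit.\<close>

lemma step_inj:
  assumes p: "p \<in> routings" and "a < A" "k < d"
  shows "inj_on (step D p a k) V"
proof (rule inj_onI)
  fix z z' assume z: "z \<in> V" and z': "z' \<in> V" and eq: "step D p a k z = step D p a k z'"
  define g where "g = take k z @ drop (Suc k) z"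
  have len: "length z = d" "length z' = d"
    using z z' by (auto simp: V_def)
  have g': "take k z' @ drop (Suc k) z' = g"
    using step_other_digits[of k D p a z] step_other_digits[of k D p a z'] eq by (simp add: g_def)
  let ?j = "\<lambda>z. p (a, k, g) (z ! k div 2)"
  let ?e = "\<lambda>z. (z ! k + of_bool (((a, k, g), z ! k div 2, ?j z) \<in> D)) mod 2"
  have "step D p a k z ! k = step D p a k z' ! k"
    using eq by simp
  then have *: "2 * ?j z + ?e z = 2 * ?j z' + ?e z'"
    using len \<open>k < d\<close> g' unfolding step_def Let_def g_def[symmetric] by simp
  have "?j z = ?j z'"
    using arg_cong[OF *, of "\<lambda>v. v div 2"] by simp
  moreover have "inj (p (a, k, g))"
    using routing_permutes[OF p switch_of_node[OF assms(2,3) z]] permutes_inj g_def by blast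
  ultimately have i: "z ! k div 2 = z' ! k div 2"
    by (meson injD)
  with * have "(z ! k) mod 2 = (z' ! k) mod 2"
    by (auto simp: of_bool_def mod_Suc split: if_splits) 
  with i have "z ! k = z' ! k"
    by (metis div_mult_mod_eq)
  moreover have "take k z = take k z'" "drop (Suc k) z = drop (Suc k) z'"
    using g' len unfolding g_def by (simp_all add: append_eq_append_conv)
  ultimately show "z = z'"
    using id_take_nth_drop[of k z] id_take_nth_drop[of k z'] len \<open>k < d\<close> by simp
qed

text \<open>Every step is an injective self-map of the finite set \<open>V\<close>, hence onto: the
  paths of a routing visit all nodes of each level.\<close>

lemma node_image:
  assumes "p \<in> routings" "a < A" "k \<le> d"
  shows "node D p a k ` V = V"
  using assms(3)
proof (induction k)
  case (Suc k)
  have "node D p a (Suc k) ` V = step D p a k ` node D p a k ` V"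
    by (auto simp: image_image)
  also have "\<dots> = step D p a k ` V"
    using Suc by simp
  also have "\<dots> = V"
    using Suc assms by (intro endo_inj_surj finite_V step_inj) (auto intro: step_in_V)
  finally show ?case .
qed auto

lemma length_step [simp]: "length (step D p a k z) = length z"
  by (simp add: step_def Let_def)

lemma length_node [simp]: "length (node D p a k x) = length x"
  by (induction k) auto

lemma drop_node: "drop k (node D p a k x) = drop k x"
proof (induction k)
  case (Suc k)
  have "drop (Suc k) (node D p a (Suc k) x) = drop (Suc k) (node D p a k x)"
    by (simp add: step_def Let_def)
  also have "\<dots> = drop 1 (drop k (node D p a k x))"
    by simp
  finally show ?case
    unfolding Suc by simp
qed simp

lemma take_node: "k \<le> l \<Longrightarrow> take k (node D p a l x) = take k (node D p a k x)"
proof (induction l rule: dec_induct)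
  case (step l)
  then show ?case by (simp add: butterfly.step_def Let_def)
qed simp

text \<open>Step \<open>k\<close> alone touches digit \<open>k\<close>: before it the digit is that
  of the source, after it that of the sink.\<close>

lemma node_eq: "k \<le> d \<Longrightarrow> node D p a k x = take k (dest D p a x) @ drop k x"
  unfolding dest_def take_node by (metis append_take_drop_id drop_node)

lemma dest_in_V:
  assumes "p \<in> routings" "a < A" "x \<in> V"
  shows "dest D p a x \<in> V"
  using node_image[OF assms(1,2) order_refl] assms(3) unfolding dest_def by blast

lemma dest_nth:
  fixes D p a
  assumes "x \<in> V" "k < d"
  defines "\<iota> \<equiv> (a, k, take k (dest D p a x) @ drop (Suc k) x)"
  defines "j \<equiv> p \<iota> (x ! k div 2)"
  shows "dest D p a x ! k = 2 * j + (x ! k + of_bool ((\<iota>, x ! k div 2, j) \<in> D)) mod 2"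
proof -
  let ?y = "dest D p a x" and ?z = "node D p a k x"
  have len: "length x = d" "length ?y = d"
    using assms(1) by (auto simp: V_def dest_def)
  have z: "?z = take k ?y @ drop k x"
    using assms(2) by (simp add: node_eq)
  then have zk: "?z ! k = x ! k" "take k ?z @ drop (Suc k) ?z = take k ?y @ drop (Suc k) x"
    using len assms(2) by (simp_all add: nth_append min_def)
  have "?y ! k = node D p a (Suc k) x ! k"
    using node_eq[of "Suc k" D p a x] assms(2) len by (simp add: nth_append del: node.simps)
  also have "\<dots> = 2 * j + (x ! k + of_bool ((\<iota>, x ! k div 2, j) \<in> D)) mod 2"
    using len assms(2) zk by (simp add: step_def Let_def \<iota>_def j_def)
  finally show ?thesis .
qed

text \<open>The summand \<open>2 * j\<close> does not affect parity, and the low bits of source and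
  sink differ exactly when the slot lies in \<open>D\<close>.\<close>

lemma clear_dest:
  assumes "x \<in> V"
  shows "clear D a x (dest D p a x)"
  unfolding clear_def
proof (intro allI impI)
  fix k assume k: "k < d"
  show "odd (x ! k + dest D p a x ! k) =
     (((a, k, take k (dest D p a x) @ drop (Suc k) x), x ! k div 2, dest D p a x ! k div 2) \<in> D)"
    unfolding dest_nth[OF assms k, of D p a] by (auto simp: of_bool_def)
qed

text \<open>The paths of a routing pass through every node of every level, so clearness of all of them
  pins the data down on the whole graph of the routing.\<close>
lemma clear_dest_determines:
  assumes p: "p \<in> routings" and \<iota>: "\<iota> \<in> switches" and i: "i < b"
    and clear: "\<And>a x. a < A \<Longrightarrow> x \<in> V \<Longrightarrow> clear D' a x (dest D p a x)"
  shows "(\<iota>, i, p \<iota> i) \<in> D' \<longleftrightarrow> (\<iota>, i, p \<iota> i) \<in> D"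
proof -
  obtain a k g where akg: "\<iota> = (a, k, g)" "a < A" "k < d" "set g \<subseteq> {..<2 * b}" "length g = d - 1"
    using \<iota> unfolding switches_def by auto
  \<comment> \<open>A node at this switch whose digit \<open>k\<close> lies over \<open>i\<close>;
    of the two such digits, \<open>2 * i\<close> is as good as \<open>2 * i + 1\<close>. Some path
    of the routing passes through it.\<close>
  define z where "z = take k g @ (2 * i) # drop k g"
  have "z \<in> V"
    using akg i set_take_subset[of k g] set_drop_subset[of k g] by (auto simp: z_def V_def)
  then obtain x where x: "x \<in> V" "z = node D p a k x"
    using node_image[OF p akg(2), of k D] akg(3) by auto
  let ?y = "dest D p a x"
  have len: "length x = d" "length ?y = d"
    using x by (auto simp: V_def dest_def)
  have z: "take k g @ (2 * i) # drop k g = take k ?y @ drop k x"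
    using node_eq[of k D p a x] akg(3) x(2) by (simp add: z_def)
  then have "take k g = take k ?y" "(2 * i) # drop k g = drop k x"
    using akg len by (auto simp: append_eq_append_conv)
  then have g: "g = take k ?y @ drop (Suc k) x" and xk: "x ! k = 2 * i"
    by (metis append_take_drop_id drop_Suc tl_drop list.sel(3),
        metis akg(3) len(1) Cons_nth_drop_Suc list.inject)
  have *: "odd (x ! k + ?y ! k) = ((\<iota>, i, ?y ! k div 2) \<in> E)" if "clear E a x ?y" for E
    using that akg(1,3) g xk unfolding clear_def by auto
  have "?y ! k div 2 = p \<iota> i"
    using dest_nth[OF x(1) akg(3), of D p a] by (simp add: xk akg(1) flip: g)
  then show ?thesis
    using *[OF clear_dest[OF x(1)]] *[OF clear[OF akg(2) x(1)]] by simp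
qed

subsection \<open>The probe bound\<close>

definition graph_union where
  "graph_union P = {(\<iota>, i, p \<iota> i) | \<iota> i p. \<iota> \<in> switches \<and> i < b \<and> p \<in> P}"

lemma graph_union_subset: "P \<subseteq> routings \<Longrightarrow> graph_union P \<subseteq> slots"
  using permutes_in_image[OF routing_permutes] unfolding graph_union_def slots_def by fastforce

text \<open>A routing picks one target for each pair of a switch and an input, among those that
  \<open>graph_union P\<close> offers. The numbers of offers add up to the size of that union, so
  few slots admit few routings.\<close>

lemma card_routings_le_graph_union:
  fixes y :: real
  assumes P: "P \<subseteq> routings" and "0 < y"
  shows "real (card P) \<le> y ^ (card switches * b) *
    exp (real (card (graph_union P)) / y - real (card switches * b))"
proof -
  let ?J = "switches \<times> {..<b}"
  let ?N = "\<lambda>(\<iota>, i). {j. (\<iota>, i, j) \<in> graph_union P}"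
  let ?h = "\<lambda>p. restrict (\<lambda>(\<iota>, i). p \<iota> i) ?J"
  have finU: "finite (graph_union P)"
    using graph_union_subset[OF P] finite_slots finite_subset by blast
  have finN: "finite (?N \<iota>)" for \<iota>
  proof (cases \<iota>)
    case (Pair \<kappa> i)
    have "?N \<iota> \<subseteq> (\<lambda>u. snd (snd u)) ` graph_union P"
      by (force simp: Pair)
    then show ?thesis
      using finU finite_surj by blast
  qed
  have "inj_on ?h P"
  proof (rule inj_onI)
    fix p p' assume p: "p \<in> P" "p' \<in> P" and eq: "?h p = ?h p'"
    have "p \<iota> = p' \<iota>" if "\<iota> \<in> switches" for \<iota>
    proof
      fix i
      show "p \<iota> i = p' \<iota> i"
      proof (cases "i < b")
        case True
        then show ?thesis
          using fun_cong[OF eq, of "(\<iota>, i)"] that by simp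
      next
        case False
        then show ?thesis
          using routing_permutes[of p \<iota>] routing_permutes[of p' \<iota>] p P that
          by (metis in_mono lessThan_iff permutes_not_in)
      qed
    qed
    then show "p = p'"
      using p P unfolding routings_def by (intro PiE_ext[of p switches _ p']) auto
  qed
  moreover have "?h ` P \<subseteq> PiE ?J ?N"
    by (auto simp: graph_union_def PiE_def Pi_def)
  ultimately have "card P \<le> card (PiE ?J ?N)"
    using finite_switches finN by (intro card_inj_on_le[of ?h] finite_PiE) auto
  also have "real \<dots> \<le> y ^ card ?J * exp ((\<Sum>\<iota>\<in>?J. real (card (?N \<iota>))) / y - real (card ?J))"
    using finite_switches finN \<open>0 < y\<close> by (intro card_PiE_le_exp) auto
  also have "(\<Sum>\<iota>\<in>?J. real (card (?N \<iota>))) = real (card (Sigma ?J ?N))"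
    using finite_switches finN by (subst card_SigmaI) auto
  also have "card (Sigma ?J ?N) = card (graph_union P)"
  proof (rule bij_betw_same_card)
    show "bij_betw (\<lambda>((\<iota>, i), j). (\<iota>, i, j)) (Sigma ?J ?N) (graph_union P)"
      by (rule bij_betw_byWitness[where f' = "\<lambda>(\<iota>, i, j). ((\<iota>, i), j)"])
        (auto simp: graph_union_def)
  qed
  finally show ?thesis
    by (simp add: card_cartesian_product)
qed

text \<open>With \<open>y\<close> the square root of \<open>b\<close>, slots that leave about
  \<open>y\<close> targets per input admit about \<open>y ^ N\<close> routings, far fewer than the
  order of \<open>b ^ N\<close> available up to \<open>exp N\<close>. So many routings with one cell
  set need a large union \<open>U\<close> of slots, while the information in those cells bounds
  \<open>U\<close> from above.\<close>

theorem probe_lower_bound: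
  fixes M :: "((nat \<times> nat \<times> nat list) \<times> nat \<times> nat) set \<Rightarrow> mem"
    and tr :: "nat \<Rightarrow> nat list \<Rightarrow> nat list \<Rightarrow> 'r probe_tree"
    and \<sigma> y :: real
  assumes pos: "0 < A" "0 < b" "0 < d" "0 < s"
    and cost: "\<And>D a x z. D \<subseteq> slots \<Longrightarrow> a < A \<Longrightarrow> x \<in> V \<Longrightarrow> z \<in> V \<Longrightarrow>
      snd (snd (exec s w (tr a x z) (M D))) \<le> t"
    and correct: "\<And>D a x z. D \<subseteq> slots \<Longrightarrow> a < A \<Longrightarrow> x \<in> V \<Longrightarrow> z \<in> V \<Longrightarrow>
      Q (fst (exec s w (tr a x z) (M D))) \<longleftrightarrow> clear D a x z"
    and \<sigma>: "1 \<le> \<sigma>" "real s \<le> \<sigma> * real (A * (2 * b) ^ d)"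
    and y: "1 \<le> y" "y\<^sup>2 = real b"
  shows "real d * ln y \<le> 6 + 6 * real t * ln \<sigma> + 2 * real t * real w / y"
proof -
  \<comment> \<open>A routing has \<open>A * (2 * b) ^ d\<close> paths, each costing at most
    \<open>t\<close> probes.\<close>
  define r where "r = A * (2 * b) ^ d * t"
  define \<C> where "\<C> = {C. C \<subseteq> {..<s} \<and> card C \<le> r}"
  define cells where
    "cells D p = (\<Union>a<A. \<Union>x\<in>V. probes s w (tr a x (dest D p a x)) (M D))" for D p
  have finC: "finite \<C>" and neC: "{} \<in> \<C>" and finCm: "\<And>C. C \<in> \<C> \<Longrightarrow> finite C"
    unfolding \<C>_def using finite_subset[of _ "{..<s}"] by auto
  have cells_in: "cells D p \<in> \<C>" if D: "D \<subseteq> slots" and p: "p \<in> routings" for D p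
  proof -
    have "card (cells D p) \<le> (\<Sum>a<A. card (\<Union>x\<in>V. probes s w (tr a x (dest D p a x)) (M D)))"
      unfolding cells_def by (intro card_UN_le) auto
    also have "\<dots> \<le> (\<Sum>a<A. \<Sum>x\<in>V. card (probes s w (tr a x (dest D p a x)) (M D)))"
      by (intro sum_mono card_UN_le finite_V)
    also have "\<dots> \<le> (\<Sum>a<A. \<Sum>x\<in>V. t)"
    proof (intro sum_mono)
      fix a x assume "a \<in> {..<A}" "x \<in> V"
      then have "snd (snd (exec s w (tr a x (dest D p a x)) (M D))) \<le> t"
        by (intro cost[OF D] dest_in_V[OF p]) auto
      then show "card (probes s w (tr a x (dest D p a x)) (M D)) \<le> t"
        using card_probes_le order_trans by blast
    qed
    also have "\<dots> = r"
      by (simp add: r_def card_V)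
    finally have "card (cells D p) \<le> r" .
    moreover have "cells D p \<subseteq> {..<s}"
      unfolding cells_def by (intro UN_least probes_subset[OF pos(4)])
    ultimately show ?thesis
      by (simp add: \<C>_def)
  qed
  \<comment> \<open>First pigeonhole: for each \<open>D\<close>, a cell set shared by the largest
    number of routings that averaging guarantees.\<close>
  have "\<forall>D\<in>Pow slots. \<exists>C\<in>\<C>. card routings \<le> card \<C> * card {p \<in> routings. cells D p = C}"
  proof
    fix D assume "D \<in> Pow slots"
    then have "cells D ` routings \<subseteq> \<C>"
      using cells_in by auto
    moreover have "\<C> \<noteq> {}"
      using neC by auto
    ultimately show "\<exists>C\<in>\<C>. card routings \<le> card \<C> * card {p \<in> routings. cells D p = C}"
      by (rule pigeonhole_card[OF finite_routings finC, rotated])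
  qed
  from bchoice[OF this[unfolded Bex_def]] obtain CD where
    "\<forall>D\<in>Pow slots. CD D \<in> \<C> \<and> card routings \<le> card \<C> * card {p \<in> routings. cells D p = CD D}" ..
  then have CD: "\<And>D. D \<subseteq> slots \<Longrightarrow> CD D \<in> \<C>"
    "\<And>D. D \<subseteq> slots \<Longrightarrow> card routings \<le> card \<C> * card {p \<in> routings. cells D p = CD D}"
    by simp_all
  define Y where "Y = Sigma \<C> (\<lambda>C. PiE C (\<lambda>_. {..<2 ^ w :: nat}))"
  \<comment> \<open>The chosen cell set together with its contents; the second pigeonhole yields a
    large family \<open>F\<close> of sets \<open>D\<close> with one view.\<close>
  define view where "view D = (CD D, restrict (\<lambda>i. M D i mod 2 ^ w) (CD D))" for D
  have finY: "finite Y"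
    unfolding Y_def using finC finCm by (intro finite_SigmaI finite_PiE) auto
  have cardY: "card Y \<le> card \<C> * 2 ^ (w * r)"
  proof -
    have "card Y = (\<Sum>C\<in>\<C>. (2 ^ w) ^ card C)"
      unfolding Y_def using finC finCm by (subst card_SigmaI) (auto intro!: finite_PiE simp: card_PiE)
    also have "\<dots> \<le> (\<Sum>C\<in>\<C>. (2 ^ w) ^ r)"
      by (intro sum_mono power_increasing) (auto simp: \<C>_def)
    finally show ?thesis
      by (simp add: power_mult)
  qed
  have view_in: "view ` Pow slots \<subseteq> Y"
    using CD(1) by (auto simp: view_def Y_def)
  then have "Y \<noteq> {}" by blast
  from pigeonhole_card[OF finite_Pow_iff[THEN iffD2, OF finite_slots] finY this view_in]
  obtain cv where cv: "card (Pow slots) \<le> card Y * card {D \<in> Pow slots. view D = cv}" ..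
  define F where "F = {D \<in> Pow slots. view D = cv}"
  have "card (Pow slots) > 0"
    using finite_slots by (auto simp: card_gt_0_iff)
  then have "card F > 0"
    using cv by (fold F_def) (metis gr0I le_zero_eq mult_0_right)
  then have "F \<noteq> {}"
    by auto
  then obtain D0 where D0: "D0 \<in> F" by blast
  then have D0s: "D0 \<subseteq> slots" by (simp add: F_def)
  define P where "P = {p \<in> routings. cells D0 p = CD D0}"
  define U where "U = graph_union P"
  have PR: "P \<subseteq> routings" by (auto simp: P_def)
  have Us: "U \<subseteq> slots"
    unfolding U_def by (rule graph_union_subset[OF PR])
  have agree: "u \<in> D \<longleftrightarrow> u \<in> D0" if D: "D \<in> F" and u: "u \<in> U" for D u
  proof -
    obtain \<iota> i p where p: "u = (\<iota>, i, p \<iota> i)" "\<iota> \<in> switches" "i < b" "p \<in> P"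
      using u by (auto simp: U_def graph_union_def)
    have Ds: "D \<subseteq> slots" and v: "view D = view D0"
      using D D0 by (auto simp: F_def)
    have same: "M D0 c mod 2 ^ w = M D c mod 2 ^ w" if "c \<in> CD D0" for c
    proof -
      have "CD D = CD D0" "restrict (\<lambda>i. M D i mod 2 ^ w) (CD D) = restrict (\<lambda>i. M D0 i mod 2 ^ w) (CD D0)"
        using v unfolding view_def by (blast dest: Pair_inject)+
      with fun_cong[OF this(2), of c] that show ?thesis
        by simp
    qed
    \<comment> \<open>The paths are those of \<open>D0\<close>, not of \<open>D\<close>: their
      queries probe only cells on which both memories agree, so the answers, and hence clearness,
      carry over to \<open>D\<close>.\<close>
    have "clear D a x (dest D0 p a x)" if a: "a < A" and x: "x \<in> V" for a x
    proof -
      let ?z = "dest D0 p a x"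
      have z: "?z \<in> V"
        using p(4) PR a x by (auto intro: dest_in_V)
      have "probes s w (tr a x ?z) (M D0) \<subseteq> cells D0 p"
        using a x by (auto simp: cells_def)
      then have "fst (exec s w (tr a x ?z) (M D)) = fst (exec s w (tr a x ?z) (M D0))"
        using p(4) by (intro exec_agree_on_probes same) (auto simp only: P_def mem_Collect_eq)
      then show ?thesis
        using correct[OF Ds a x z] correct[OF D0s a x z] clear_dest[OF x] by simp
    qed
    then show ?thesis
      using clear_dest_determines[of p \<iota> i D D0] p PR by auto
  qed
  have cardF: "card F * 2 ^ card U \<le> 2 ^ card slots"
  proof -
    \<comment> \<open>All members of \<open>F\<close> coincide with \<open>D0\<close> on
      \<open>U\<close>, so only the part outside \<open>U\<close> is free.\<close>
    have "inj_on (\<lambda>D. D - U) F"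
      by (rule inj_onI) (use agree in blast)
    moreover have "(\<lambda>D. D - U) ` F \<subseteq> Pow (slots - U)"
      by (auto simp: F_def)
    ultimately have "card F \<le> card (Pow (slots - U))"
      using finite_slots by (intro card_inj_on_le[of "\<lambda>D. D - U"]) auto
    also have "\<dots> = 2 ^ (card slots - card U)"
      using finite_slots Us by (simp add: card_Pow card_Diff_subset finite_subset)
    finally have "card F * 2 ^ card U \<le> 2 ^ (card slots - card U) * 2 ^ card U"
      by simp
    also have "\<dots> = 2 ^ card slots"
      using card_mono[OF finite_slots Us] by (simp flip: power_add)
    finally show ?thesis .
  qed
  have "2 ^ card slots * 2 ^ card U \<le> (card Y * card F) * 2 ^ card U"
    using cv finite_slots by (simp add: F_def card_Pow)
  also have "\<dots> \<le> card Y * 2 ^ card slots"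
    using mult_left_mono[OF cardF, of "card Y"] by (simp add: mult_ac)
  finally have "2 ^ card U \<le> card Y"
    by simp
  with cardY have "2 ^ card U \<le> card \<C> * 2 ^ (w * r)"
    by linarith
  then have U2: "(2::real) ^ card U \<le> real (card \<C>) * 2 ^ (w * r)"
    by (metis (mono_tags) of_nat_le_iff of_nat_mult of_nat_numeral of_nat_power)

  define K where "K = real (A * (2 * b) ^ d)"
  have K: "K > 0" using pos by (simp add: K_def)
  define H where "H = ln (real (card \<C>))"
  have Cpos: "real (card \<C>) \<ge> 1"
    using finC neC by (metis One_nat_def Suc_leI card_gt_0_iff empty_iff of_nat_1 of_nat_le_iff)
  have H0: "H \<ge> 0" using Cpos by (simp add: H_def)
  \<comment> \<open>The weight is \<open>\<sigma>\<close>, since there are at most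
    \<open>\<sigma> * K\<close> cells and the exponential then costs only \<open>K\<close>.\<close>
  have "real (card \<C>) \<le> exp (real s / \<sigma>) * \<sigma> ^ r"
    unfolding \<C>_def by (rule card_small_subsets_le[OF \<sigma>(1)])
  then have "H \<le> ln (exp (real s / \<sigma>) * \<sigma> ^ r)"
    unfolding H_def using Cpos by (intro ln_mono) auto
  also have "\<dots> = real s / \<sigma> + real r * ln \<sigma>"
    using \<sigma>(1) by (simp add: ln_mult ln_realpow)
  also have "real s / \<sigma> \<le> K"
    using \<sigma> by (simp add: K_def field_simps)
  finally have H: "H \<le> K * (1 + real t * ln \<sigma>)"
    by (simp add: r_def K_def algebra_simps)
  have "real (card U) * ln 2 \<le> H + real (w * r) * ln 2"
    using ln_mono[OF U2] Cpos by (simp add: ln_mult ln_realpow H_def)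
  then have "(real (card U) - real (w * r)) * ln 2 \<le> H"
    by (simp add: algebra_simps)
  moreover have "(1 / 2 :: real) \<le> ln 2"
    using ln_le_minus_one[of "1 / 2 :: real"] by (simp add: ln_div)
  ultimately have U: "real (card U) \<le> 2 * H + real (w * r)"
    using H0 mult_left_mono[of "1 / 2" "ln 2" "real (card U) - real (w * r)"] by fastforce
  define N where "N = card switches * b"
  \<comment> \<open>The factor \<open>1 / 2\<close> arises because each switch has
    \<open>2 * b\<close> digits but only \<open>b\<close> inputs to route.\<close>
  have N: "real N = K * real d / 2"
  proof -
    have "(2 * b) ^ d = 2 * b * (2 * b) ^ (d - 1)"
      using pos(3) by (metis power_eq_if less_numeral_extra(3))
    then show ?thesis
      by (simp add: N_def K_def card_switches)
  qed
  \<comment> \<open>The Stirling loss \<open>exp N\<close> cancels exactly against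
    \<open>exp (- N)\<close> from the bound on \<open>card P\<close>.\<close>
  have "real b ^ N = (real b ^ b) ^ card switches"
    by (simp add: N_def power_mult mult.commute)
  also have "\<dots> \<le> (fact b * exp (real b)) ^ card switches"
    by (intro power_mono power_le_fact_exp) auto
  also have "\<dots> = real (card routings) * exp (real N)"
    by (simp add: card_routings power_mult_distrib N_def flip: exp_of_nat_mult)
  also have "\<dots> \<le> (real (card \<C>) * real (card P)) * exp (real N)"
    using CD(2)[OF D0s] by (intro mult_right_mono) (auto simp: P_def simp flip: of_nat_mult)
  also have "\<dots> \<le> (real (card \<C>) * (y ^ N * exp (real (card U) / y - real N))) * exp (real N)"
    using card_routings_le_graph_union[OF PR, of y] y(1) unfolding N_def U_def
    by (intro mult_right_mono mult_left_mono) auto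
  also have "\<dots> = real (card \<C>) * (y ^ N * exp (real (card U) / y))"
    by (simp flip: exp_add)
  finally have "ln (real b ^ N) \<le> ln (real (card \<C>) * (y ^ N * exp (real (card U) / y)))"
    using pos by (intro ln_mono) auto
  then have "real N * ln (real b) \<le> H + (real N * ln y + real (card U) / y)"
    using y(1) Cpos pos by (simp add: ln_mult ln_realpow H_def)
  moreover have "ln (real b) = 2 * ln y"
    using y by (simp add: ln_realpow flip: y(2))
  ultimately have "real N * ln y \<le> H + real (card U) / y"
    by (simp add: algebra_simps)
  also have "real (card U) / y \<le> (2 * H + real (w * r)) / y"
    using U y(1) by (intro divide_right_mono) auto
  also have "\<dots> = 2 * H / y + real (w * r) / y"
    by (simp add: add_divide_distrib)
  also have "2 * H / y \<le> 2 * H"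
    using y(1) H0 by (simp add: field_simps mult_left_mono)
  finally have "K * real d / 2 * ln y \<le> 3 * H + real (w * r) / y"
    by (simp add: N)
  also have "\<dots> \<le> 3 * (K * (1 + real t * ln \<sigma>)) + real (w * r) / y"
    using H by simp
  also have "real (w * r) / y = K * (real t * real w / y)"
    by (simp add: r_def K_def)
  finally have "K * (real d * ln y) \<le> K * (6 + 6 * real t * ln \<sigma> + 2 * real t * real w / y)"
    by (simp add: algebra_simps)
  then show ?thesis
    using K by simp
qed

subsection \<open>Encoding butterflies in strings\<close>

text \<open>Letters below \<open>2 * b\<close> are digits, \<open>2 * b + a\<close> names the butterfly \<open>a < A\<close>, the letter
  \<open>2 * b + A\<close> is the placeholder between \<open>x\<close> and \<open>y\<close> in the dynamic string, and \<open>2 * b + A + 1\<close>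
  terminates the patterns of the static string.\<close>
definition pattern :: "nat \<Rightarrow> nat \<Rightarrow> nat list \<Rightarrow> nat \<Rightarrow> nat \<Rightarrow> nat list" where
  "pattern a k g q r = (q # drop k g) @ [2 * b + a] @ take k g @ [r]"

text \<open>A pattern spells the window from digit \<open>k\<close> of \<open>x\<close> to digit
  \<open>k\<close> of \<open>y\<close> in \<open>x @ [2 * b + a] @ y\<close>. Its length is
  \<open>d + 2\<close> for every \<open>k\<close>, so one threshold serves all levels.\<close>

definition bad_patterns :: "((nat \<times> nat \<times> nat list) \<times> nat \<times> nat) set \<Rightarrow> nat list set" where
  "bad_patterns D = {pattern a k g q r | a k g q r. (a, k, g) \<in> switches \<and> q < 2 * b \<and> r < 2 * b \<and>
     odd (q + r) \<noteq> (((a, k, g), q div 2, r div 2) \<in> D)}"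

lemma bad_patterns_subset:
  "bad_patterns D \<subseteq> (\<lambda>((a, k, g), q, r). pattern a k g q r) ` (switches \<times> {..<2 * b} \<times> {..<2 * b})"
  unfolding bad_patterns_def by force

lemma finite_bad_patterns: "finite (bad_patterns D)"
  by (rule finite_subset[OF bad_patterns_subset]) (simp add: finite_switches)

lemma card_bad_patterns: "0 < d \<Longrightarrow> card (bad_patterns D) \<le> A * d * (2 * b) ^ (d + 1)"
proof -
  assume "0 < d"
  have "card (bad_patterns D) \<le> card (switches \<times> {..<2 * b} \<times> {..<2 * b})"
    using finite_switches
    by (intro order_trans[OF card_mono[OF _ bad_patterns_subset] card_image_le]) auto
  also have "\<dots> = A * d * (2 * b) ^ (d - 1 + 2)"
    by (simp add: card_cartesian_product card_switches power_add power2_eq_square)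
  finally show ?thesis
    using \<open>0 < d\<close> by simp
qed

lemma bad_pattern_props:
  assumes "v \<in> bad_patterns D"
  shows "length v = d + 2" "set v \<subseteq> {..<2 * b + A}"
proof -
  obtain a k g q r where v: "v = pattern a k g q r" "(a, k, g) \<in> switches" "q < 2 * b" "r < 2 * b"
    using assms unfolding bad_patterns_def by blast
  then show "length v = d + 2" "set v \<subseteq> {..<2 * b + A}"
    using set_take_subset[of k g] set_drop_subset[of k g]
    by (auto simp: pattern_def switches_def)
qed

text \<open>The string holds exactly one butterfly letter, so an occurrence of a pattern must align
  with it and thereby reads digits of \<open>x\<close> and \<open>y\<close> only.\<close>

lemma clear_iff_no_bad_pattern:
  assumes x: "x \<in> V" and y: "y \<in> V" and a: "a < A"
    and S: "S = pre @ x @ [2 * b + a] @ y @ post"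
    and pre: "set pre \<subseteq> {..<2 * b} \<union> {2 * b + A}" and post: "set post \<subseteq> {..<2 * b} \<union> {2 * b + A}"
  shows "clear D a x y \<longleftrightarrow> \<not> (\<exists>v\<in>bad_patterns D. \<exists>p1 p2. S = p1 @ v @ p2)"
proof -
  have len: "length x = d" "length y = d" and dig: "set x \<subseteq> {..<2 * b}" "set y \<subseteq> {..<2 * b}"
    using x y by (auto simp: V_def)
  have factor: "S = (pre @ take k x) @ (drop k x @ [2 * b + a] @ take (Suc k) y) @ (drop (Suc k) y @ post)" for k
    unfolding S by (metis append_assoc append_take_drop_id)
  show ?thesis
  proof (intro iffI notI)
    assume clear: "clear D a x y" and "\<exists>v\<in>bad_patterns D. \<exists>p1 p2. S = p1 @ v @ p2"
    then obtain v p1 p2 where v: "v \<in> bad_patterns D" "S = p1 @ v @ p2" by blast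
    then obtain a' k g q r where v': "v = pattern a' k g q r" "(a', k, g) \<in> switches" "q < 2 * b" "r < 2 * b"
      "odd (q + r) \<noteq> (((a', k, g), q div 2, r div 2) \<in> D)"
      unfolding bad_patterns_def by blast
    have akg: "a' < A" "k < d" "length g = d - 1"
      using v'(2) by (auto simp: switches_def)
    have eq: "p1 @ (q # drop k g) @ (2 * b + a') # (take k g @ [r] @ p2) = (pre @ x) @ (2 * b + a) # (y @ post)"
      using v(2) v'(1) S by (simp add: pattern_def)
    have pos: "length (p1 @ (q # drop k g)) = length (pre @ x)"
    proof (rule ccontr)
      let ?n = "length (p1 @ (q # drop k g))"
      assume ne: "?n \<noteq> length (pre @ x)"
      have "((pre @ x) @ (2 * b + a) # (y @ post)) ! ?n = 2 * b + a'"
        unfolding eq[symmetric] by (metis append_assoc nth_append_length)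
      moreover have "?n < length ((pre @ x) @ (2 * b + a) # (y @ post))"
        unfolding eq[symmetric] by simp
      ultimately have "2 * b + a' \<in> set (pre @ x) \<union> set (y @ post)"
        using ne by (rule nth_other_in_set)
      then show False
        using pre post dig akg(1) by auto
    qed
    have eq2: "p1 @ (q # drop k g) = pre @ x" "a' = a" "take k g @ [r] @ p2 = y @ post"
      using eq pos append_eq_append_conv[of "p1 @ (q # drop k g)" "pre @ x"
          "(2 * b + a') # (take k g @ [r] @ p2)" "(2 * b + a) # (y @ post)"] by simp_all
    have "q # drop k g = drop k x"
      \<comment> \<open>The pattern has \<open>d - k\<close> letters before the butterfly letter,
        which is at most the length of \<open>x\<close>.\<close>
      using arg_cong[OF eq2(1), of "\<lambda>u. drop (length u - (d - k)) u"] pos akg len by simp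
    moreover have "take k g @ [r] = take (Suc k) y"
      using arg_cong[OF eq2(3), of "take (Suc k)"] akg len by simp
    ultimately have "x ! k = q" "y ! k = r" "take k g = take k y" "drop k g = drop (Suc k) x"
      using akg len by (auto simp: take_Suc_conv_app_nth Cons_nth_drop_Suc[symmetric])
    moreover from this have "g = take k y @ drop (Suc k) x"
      by (metis append_take_drop_id)
    ultimately show False
      using clear akg v'(5) eq2(2) unfolding clear_def by auto
  next
    assume no: "\<not> (\<exists>v\<in>bad_patterns D. \<exists>p1 p2. S = p1 @ v @ p2)"
    show "clear D a x y"
      unfolding clear_def
    proof (intro allI impI, rule ccontr)
      fix k assume k: "k < d"
      let ?g = "take k y @ drop (Suc k) x"
      assume "odd (x ! k + y ! k) \<noteq> (((a, k, ?g), x ! k div 2, y ! k div 2) \<in> D)"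
      moreover have "(a, k, ?g) \<in> switches"
        using k a len dig set_take_subset[of k y] set_drop_subset[of "Suc k" x] by (auto simp: switches_def)
      moreover have "x ! k < 2 * b" "y ! k < 2 * b"
        using k len dig by (metis lessThan_iff nth_mem subset_iff)+
      ultimately have "pattern a k ?g (x ! k) (y ! k) \<in> bad_patterns D"
        unfolding bad_patterns_def by blast
      moreover have "pattern a k ?g (x ! k) (y ! k) = drop k x @ [2 * b + a] @ take (Suc k) y"
        using k len by (simp add: pattern_def take_Suc_conv_app_nth flip: Cons_nth_drop_Suc)
      ultimately show False
        using no factor[of k] by metis
    qed
  qed
qed

text \<open>The terminator is absent from the dynamic string, so a common substring of length
  \<open>d + 2\<close> is a whole pattern. The factor \<open>d + 3\<close> counts a pattern with its
  terminator.\<close>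

lemma static_string_exists:
  assumes "0 < d" "A * d * (2 * b) ^ (d + 1) * (d + 3) \<le> n" "2 * b + A + 2 \<le> n"
  shows "\<exists>T. str_n n T \<and> (\<forall>a x y pre post ans. a < A \<longrightarrow> x \<in> V \<longrightarrow> y \<in> V \<longrightarrow>
    set pre \<subseteq> {..<2 * b} \<union> {2 * b + A} \<longrightarrow> set post \<subseteq> {..<2 * b} \<union> {2 * b + A} \<longrightarrow>
    is_lcs (pre @ x @ [2 * b + a] @ y @ post) T ans \<longrightarrow> (clear D a x y \<longleftrightarrow> snd (snd ans) < d + 2))"
proof -
  let ?h = "2 * b + A + 1"
  obtain es where es: "set es = bad_patterns D" "distinct es"
    using finite_distinct_list[OF finite_bad_patterns] by blast
  define T where "T = concat (map (\<lambda>e. e @ [?h]) es)"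
  have lens: "length e = d + 2" "set e \<subseteq> {..<2 * b + A}" if "e \<in> set es" for e
    using that bad_pattern_props es by auto
  have "length T = length es * (d + 3)"
    using lens(1) unfolding T_def by (induction es) auto
  moreover have "length es \<le> A * d * (2 * b) ^ (d + 1)"
    using card_bad_patterns[OF assms(1), of D] es distinct_card by metis
  ultimately have "length T \<le> n"
    using assms(2) by (metis mult_le_mono1 order_trans)
  moreover have "set T \<subseteq> {0..<n}"
  proof
    fix c assume "c \<in> set T"
    then have "c = ?h \<or> (\<exists>e\<in>set es. c \<in> set e)"
      unfolding T_def by (auto split: if_splits)
    then have "c < 2 * b + A + 2"
      using lens(2) by fastforce
    then show "c \<in> {0..<n}"
      using assms(3) by simp
  qed
  ultimately have "str_n n T"
    by (simp add: str_n_def)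
  moreover have "clear D a x y \<longleftrightarrow> snd (snd ans) < d + 2"
    if "a < A" "x \<in> V" "y \<in> V" and pre: "set pre \<subseteq> {..<2 * b} \<union> {2 * b + A}"
      "set post \<subseteq> {..<2 * b} \<union> {2 * b + A}"
      and lcs: "is_lcs (pre @ x @ [2 * b + a] @ y @ post) T ans" for a x y pre post ans
  proof -
    let ?S = "pre @ x @ [2 * b + a] @ y @ post"
    have hS: "?h \<notin> set ?S"
      using that pre by (auto simp: V_def)
    have "d + 2 \<le> snd (snd ans) \<longleftrightarrow> (\<exists>v p1 p2 t1 t2. ?S = p1 @ v @ p2 \<and> T = t1 @ v @ t2 \<and> length v = d + 2)"
      by (rule lcs_length_ge_iff[OF lcs])
    also have "\<dots> \<longleftrightarrow> (\<exists>v\<in>bad_patterns D. \<exists>p1 p2. ?S = p1 @ v @ p2)"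
    proof
      assume "\<exists>v p1 p2 t1 t2. ?S = p1 @ v @ p2 \<and> T = t1 @ v @ t2 \<and> length v = d + 2"
      then obtain v p1 p2 t1 t2 where v: "?S = p1 @ v @ p2" "T = t1 @ v @ t2" "length v = d + 2"
        by blast
      have "?h \<notin> set v"
        using hS set_factor_subset[OF v(1)] by blast
      then have "v \<in> set es"
        using v(2,3) lens(1) unfolding T_def by (intro factor_of_terminated_concat) auto
      then show "\<exists>v\<in>bad_patterns D. \<exists>p1 p2. ?S = p1 @ v @ p2"
        using es v(1) by blast
    next
      assume "\<exists>v\<in>bad_patterns D. \<exists>p1 p2. ?S = p1 @ v @ p2"
      then obtain v p1 p2 where v: "v \<in> bad_patterns D" "?S = p1 @ v @ p2" by blast
      then obtain e1 e2 where "es = e1 @ v # e2"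
        using es by (metis split_list)
      then have "T = concat (map (\<lambda>e. e @ [?h]) e1) @ v @ (?h # concat (map (\<lambda>e. e @ [?h]) e2))"
        by (simp add: T_def)
      then show "\<exists>v p1 p2 t1 t2. ?S = p1 @ v @ p2 \<and> T = t1 @ v @ t2 \<and> length v = d + 2"
        using v(2) bad_pattern_props(1)[OF v(1)] by blast
    qed
    finally show ?thesis
      using clear_iff_no_bad_pattern[OF that(2,3,1) refl pre, of D] by linarith
  qed
  ultimately show ?thesis by blast
qed

text \<open>With a block for each pair of source and sink, any query becomes a single substitution
  in one fixed string; this costs the square of \<open>(2 * b) ^ d\<close>.\<close>

lemma dynamic_string_exists:
  assumes "((2 * b) ^ d)\<^sup>2 * (2 * d + 1) \<le> n" "2 * b + A + 2 \<le> n"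
  shows "\<exists>S. str_n n S \<and> (\<forall>x\<in>V. \<forall>y\<in>V. \<exists>pre post. S = pre @ x @ [2 * b + A] @ y @ post \<and>
    set pre \<subseteq> {..<2 * b} \<union> {2 * b + A} \<and> set post \<subseteq> {..<2 * b} \<union> {2 * b + A})"
proof -
  obtain ps where ps: "set ps = V \<times> V" "distinct ps"
    using finite_distinct_list[of "V \<times> V"] finite_V by blast
  define f where "f = (\<lambda>(x, y). x @ [2 * b + A] @ y)"
  define S where "S = concat (map f ps)"
  have f: "length (f q) = 2 * d + 1" "set (f q) \<subseteq> {..<2 * b} \<union> {2 * b + A}" if "q \<in> set ps" for q
    using that ps by (auto simp: f_def V_def)
  have "length S = length ps * (2 * d + 1)"
    using f(1) unfolding S_def by (induction ps) auto
  moreover have "length ps = ((2 * b) ^ d)\<^sup>2"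
    using distinct_card[OF ps(2)] ps(1) by (simp add: card_cartesian_product card_V power2_eq_square)
  moreover have "set S \<subseteq> {0..<n}"
  proof
    fix c assume "c \<in> set S"
    then obtain q where "q \<in> set ps" "c \<in> set (f q)"
      unfolding S_def by auto
    with f(2)[of q] assms(2) show "c \<in> {0..<n}"
      by auto
  qed
  ultimately have "str_n n S"
    using assms(1) by (simp add: str_n_def)
  moreover have "\<exists>pre post. S = pre @ x @ [2 * b + A] @ y @ post \<and>
    set pre \<subseteq> {..<2 * b} \<union> {2 * b + A} \<and> set post \<subseteq> {..<2 * b} \<union> {2 * b + A}"
    if "x \<in> V" "y \<in> V" for x y
  proof -
    have "(x, y) \<in> set ps"
      using ps(1) that by simp
    then obtain q1 q2 where q: "ps = q1 @ (x, y) # q2"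
      by (meson split_list)
    have "set (concat (map f q1)) \<subseteq> {..<2 * b} \<union> {2 * b + A}"
      "set (concat (map f q2)) \<subseteq> {..<2 * b} \<union> {2 * b + A}"
      unfolding set_concat set_map image_image by (intro UN_least f(2); simp add: q)+
    moreover have "S = concat (map f q1) @ x @ [2 * b + A] @ y @ concat (map f q2)"
      by (simp add: S_def f_def q)
    ultimately show ?thesis
      by blast
  qed
  ultimately show ?thesis by blast
qed

theorem lcs_ds_probe_bound:
  fixes \<sigma> y :: real
  assumes ds: "lcs_ds n s w init upd t"
    and pos: "0 < A" "0 < b" "0 < d"
    and n: "((2 * b) ^ d)\<^sup>2 * (2 * d + 1) \<le> n" "A * d * (2 * b) ^ (d + 1) * (d + 3) \<le> n"
      "2 * b + A + 2 \<le> n"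
    and \<sigma>: "1 \<le> \<sigma>" "real s \<le> \<sigma> * real (A * (2 * b) ^ d)"
    and y: "1 \<le> y" "y\<^sup>2 = real b"
  shows "real d * ln y \<le> 6 + 6 * real t * ln \<sigma> + 2 * real t * real w / y"
proof -
  have s: "0 < s" using ds by (simp add: lcs_ds_def)
  obtain S where S: "str_n n S" "\<forall>x\<in>V. \<forall>y\<in>V. \<exists>pre post. S = pre @ x @ [2 * b + A] @ y @ post \<and>
    set pre \<subseteq> {..<2 * b} \<union> {2 * b + A} \<and> set post \<subseteq> {..<2 * b} \<union> {2 * b + A}"
    using dynamic_string_exists[OF n(1,3)] by blast
  define ok where "ok x y j \<longleftrightarrow> (\<exists>pre post. S = pre @ x @ [2 * b + A] @ y @ post \<and>
    set pre \<subseteq> {..<2 * b} \<union> {2 * b + A} \<and> set post \<subseteq> {..<2 * b} \<union> {2 * b + A} \<and>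
    j = length (pre @ x))" for x y j
  \<comment> \<open>The position is independent of \<open>D\<close>, hence so is the decision tree
    of the query; \<open>D\<close> enters only through the preprocessed memory.\<close>
  define pos where "pos x y = (SOME j. ok x y j)" for x y
  have pos_ok: "ok x y (pos x y)" if "x \<in> V" "y \<in> V" for x y
    unfolding pos_def by (rule someI_ex) (use S(2) that in \<open>force simp: ok_def\<close>)
  define static_ok where "static_ok D T \<longleftrightarrow> str_n n T \<and> (\<forall>a x y pre post ans. a < A \<longrightarrow> x \<in> V \<longrightarrow> y \<in> V \<longrightarrow>
    set pre \<subseteq> {..<2 * b} \<union> {2 * b + A} \<longrightarrow> set post \<subseteq> {..<2 * b} \<union> {2 * b + A} \<longrightarrow>
    is_lcs (pre @ x @ [2 * b + a] @ y @ post) T ans \<longrightarrow> (clear D a x y \<longleftrightarrow> snd (snd ans) < d + 2))" for D T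
  define T where "T D = (SOME T. static_ok D T)" for D
  have T: "static_ok D (T D)" for D
    unfolding T_def by (rule someI_ex) (use static_string_exists[OF pos(3) n(2,3)] in \<open>simp only: static_ok_def\<close>)
  have run: "snd (snd (exec s w (upd (pos x y) (2 * b + a)) (init S (T D)))) \<le> t \<and>
     (snd (snd (fst (exec s w (upd (pos x y) (2 * b + a)) (init S (T D))))) < d + 2 \<longleftrightarrow> clear D a x y)"
    if a: "a < A" and xy: "x \<in> V" "y \<in> V" for D a x y
  proof -
    obtain pre post where pp: "S = pre @ x @ [2 * b + A] @ y @ post"
      "set pre \<subseteq> {..<2 * b} \<union> {2 * b + A}" "set post \<subseteq> {..<2 * b} \<union> {2 * b + A}"
      "pos x y = length (pre @ x)"
      using pos_ok[OF xy] unfolding ok_def by blast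
    have upd: "S[pos x y := 2 * b + a] = pre @ x @ [2 * b + a] @ y @ post"
      unfolding pp(1,4) by (simp add: list_update_append)
    obtain ans m' c where e: "exec s w (upd (pos x y) (2 * b + a)) (init S (T D)) = (ans, m', c)"
      by (cases "exec s w (upd (pos x y) (2 * b + a)) (init S (T D))")
    have "str_n n (T D)"
      using T[of D] by (simp add: static_ok_def)
    moreover have "reach n s w init upd (T D) (S, init S (T D))"
      by (rule reach.start[OF S(1)])
    moreover have "pos x y < length S" "2 * b + a < n"
      using pp a n(3) by auto
    ultimately have "is_lcs (S[pos x y := 2 * b + a]) (T D) ans \<and> c \<le> t"
      using ds e unfolding lcs_ds_def by fastforce
    then have lcs: "is_lcs (pre @ x @ [2 * b + a] @ y @ post) (T D) ans" and "c \<le> t"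
      unfolding upd by simp_all
    have "clear D a x y \<longleftrightarrow> snd (snd ans) < d + 2"
      using T[of D] a xy pp(2,3) lcs unfolding static_ok_def by blast
    with \<open>c \<le> t\<close> show ?thesis
      unfolding e by simp
  qed
  show ?thesis
    by (rule probe_lower_bound[where M = "\<lambda>D. init S (T D)" and tr = "\<lambda>a x y. upd (pos x y) (2 * b + a)"
          and Q = "\<lambda>ans. snd (snd ans) < d + 2", OF assms(2-4) s _ _ \<sigma> y])
      (use run in blast)+
qed

end

subsection \<open>Choice of parameters\<close>

definition sufficiently_large :: "real \<Rightarrow> real \<Rightarrow> bool" where
  "sufficiently_large cw L \<longleftrightarrow> 1 \<le> ln L \<and> ln (2 * (L ^ 3 + 1)\<^sup>2) \<le> 7 * ln L \<and> 1 \<le> L / (294 * ln L) \<and>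
    L * exp (L / 6) * (2 * (L ^ 3 + 1)\<^sup>2) * (L + 3) \<le> exp L / 2 \<and>
    exp (L / 3) * (2 * L + 1) \<le> exp L \<and> 2 * (L ^ 3 + 1)\<^sup>2 + 2 \<le> exp L / 2 \<and>
    L / ln 2 \<le> L\<^sup>2 \<and> 4 * (L ^ 3 + 1)\<^sup>2 * L * (L + 3) \<le> L ^ 9 \<and> 2 * cw \<le> L \<and> 294 \<le> L"

lemma eventually_sufficiently_large:
  "\<forall>\<^sub>F n in sequentially. sufficiently_large cw (ln (real n))"
proof -
  have "\<forall>\<^sub>F L in at_top. sufficiently_large cw L"
    unfolding sufficiently_large_def by (intro eventually_conj; real_asymp)
  moreover have "filterlim (\<lambda>n. ln (real n)) at_top sequentially"
    by real_asymp
  ultimately show ?thesis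
    by (rule eventually_compose_filterlim)
qed

text \<open>Here \<open>b\<close> is about \<open>L ^ 6\<close> and \<open>d\<close> of order
  \<open>L / ln L\<close>, so \<open>d * ln y\<close> is of order \<open>L\<close>. Since
  \<open>\<sigma>\<close> is polylogarithmic in \<open>n\<close>, each probe contributes only
  \<open>O(ln L)\<close>.\<close>

lemma lcs_ds_bound_for_large_log:
  fixes c cw L :: real
  assumes c: "c \<ge> 0" "cw > 0" and L_def: "L = ln (real n)" and n0: "n > 0"
    and large: "sufficiently_large cw L"
    and ds: "lcs_ds n s w init upd t"
    and s: "real s \<le> real n * log 2 (real n) powr c"
    and w: "real w \<le> cw * log 2 (real n)"
  shows "2 / (49 * (12 * c + 55)) * L / ln L \<le> real t"
proof -
  have a1: "1 \<le> ln L" and a2: "ln (2 * (L ^ 3 + 1)\<^sup>2) \<le> 7 * ln L"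
    and a3: "1 \<le> L / (294 * ln L)"
    and a4: "L * exp (L / 6) * (2 * (L ^ 3 + 1)\<^sup>2) * (L + 3) \<le> exp L / 2"
    and a5: "exp (L / 3) * (2 * L + 1) \<le> exp L"
    and a6: "2 * (L ^ 3 + 1)\<^sup>2 + 2 \<le> exp L / 2"
    and a7: "L / ln 2 \<le> L\<^sup>2" and a8: "4 * (L ^ 3 + 1)\<^sup>2 * L * (L + 3) \<le> L ^ 9"
    and a9: "2 * cw \<le> L" and a10: "294 \<le> L"
    using large unfolding sufficiently_large_def by blast+
  \<comment> \<open>The exponent 3 lets \<open>Y\<close> absorb \<open>2 * w\<close>, which is at
    most \<open>2 * cw * L\<^sup>2\<close>.\<close>
  define Y where "Y = nat \<lceil>L ^ 3\<rceil>"
  define b where "b = Y\<^sup>2"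
  define E where "E = ln (real (2 * b))"
  \<comment> \<open>This keeps \<open>(2 * b) ^ d\<close> below the sixth root of \<open>n\<close>,
    so its square times the block length still fits.\<close>
  define d where "d = nat \<lfloor>L / (6 * E)\<rfloor>"
  define X where "X = d * (2 * b) ^ (d + 1) * (d + 3)"
  \<comment> \<open>\<open>X\<close> bounds the static length per butterfly; \<open>A\<close> copies
    nearly fill length \<open>n\<close>, so the number of paths is within a polylogarithmic factor
    of \<open>n\<close>.\<close>
  define A where "A = n div X"
  define \<sigma> where "\<sigma> = log 2 (real n) powr c * real (4 * b * d * (d + 3))"
  have n: "exp L = real n" using n0 by (simp add: L_def)
  have L3: "L ^ 3 \<ge> 1" using a10 by (intro one_le_power) auto
  have Yl: "L ^ 3 \<le> real Y" and Yu: "real Y \<le> L ^ 3 + 1"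
    using L3 unfolding Y_def by linarith+
  have Y1: "1 \<le> real Y" using L3 Yl by linarith
  have b: "real b = (real Y)\<^sup>2" "real b \<le> (L ^ 3 + 1)\<^sup>2" "1 \<le> real b"
    using Y1 Yu by (auto simp: b_def intro!: power_mono)
  have "ln (L ^ 3) \<le> ln (real Y)"
    using Yl L3 by (intro ln_mono) linarith+
  then have lnY: "3 * ln L \<le> ln (real Y)"
    using a10 by (simp add: ln_realpow)
  have "E = ln 2 + 2 * ln (real Y)"
    using Y1 by (simp add: E_def b(1) ln_mult ln_realpow)
  then have El: "6 * ln L \<le> E" using lnY ln_gt_zero[of "2::real"] by linarith
  have E1: "1 \<le> E" using El a1 by linarith
  have "E \<le> ln (2 * (L ^ 3 + 1)\<^sup>2)"
    unfolding E_def using b(2,3) by (intro ln_mono) auto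
  then have Eu: "E \<le> 7 * ln L" using a2 by linarith
  have LE: "L / (42 * ln L) \<le> L / (6 * E)"
    using Eu E1 a10 a1 by (intro divide_left_mono) auto
  have d0: "0 \<le> L / (6 * E)" using E1 a10 by simp
  have du: "real d \<le> L / (6 * E)" and dl: "L / (6 * E) - 1 \<le> real d"
    using d0 unfolding d_def by linarith+
  \<comment> \<open>Rounding \<open>d\<close> down loses at most 1, which is covered by splitting
    \<open>1 / 42\<close> as \<open>1 / 49 + 1 / 294\<close>.\<close>
  have "L / (49 * ln L) + L / (294 * ln L) = L / (42 * ln L)"
    using a1 by (simp add: field_simps)
  then have dl': "L / (49 * ln L) \<le> real d" using dl LE a3 by linarith
  moreover have "L / (49 * ln L) = 6 * (L / (294 * ln L))"
    using a1 by (simp add: field_simps)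
  ultimately have "1 \<le> real d" using a3 by linarith
  then have d1: "1 \<le> d" by simp
  have "L / (6 * E) \<le> L / 1"
    using E1 a10 by (intro divide_left_mono) auto
  then have dL: "real d \<le> L" using du by simp
  have "real d * E \<le> L / 6" using du E1 by (simp add: field_simps)
  moreover have "real ((2 * b) ^ d) = exp (real d * E)"
    using b(3) unfolding exp_of_nat_mult E_def by (simp del: of_nat_mult)
  ultimately have m: "real ((2 * b) ^ d) \<le> exp (L / 6)" by simp
  have "X = d * (2 * b) ^ d * (2 * b) * (d + 3)" by (simp add: X_def)
  then have Xr: "real X = real d * real ((2 * b) ^ d) * (2 * real b) * (real d + 3)"
    by (simp add: algebra_simps)
  also have "\<dots> \<le> L * exp (L / 6) * (2 * (L ^ 3 + 1)\<^sup>2) * (L + 3)"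
    using dL m b a10 by (intro mult_mono) (auto intro!: mult_nonneg_nonneg)
  finally have X: "real X \<le> real n / 2" using a4 n by linarith
  have X8: "8 \<le> X"
  proof -
    have "(2 * b) ^ 1 \<le> (2 * b) ^ (d + 1)"
      using b(3) by (intro power_increasing) auto
    then have "1 * 2 * 4 \<le> X"
      unfolding X_def using d1 b(3) by (intro mult_le_mono) auto
    then show ?thesis by simp
  qed
  have Adiv: "real A * real X \<le> real n"
    unfolding A_def by (metis div_times_less_eq_dividend of_nat_le_iff of_nat_mult)
  have "n = A * X + n mod X" unfolding A_def by simp
  moreover have "n mod X < X" using X8 by simp
  ultimately have "n \<le> A * X + X" by linarith
  then have "real n \<le> real (A * X + X)"
    by (simp only: of_nat_le_iff)
  then have Al: "real n / 2 \<le> real A * real X" using X by simp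
  have A1: "0 < A" using Al n0 by (cases "A = 0") auto
  have n1: "((2 * b) ^ d)\<^sup>2 * (2 * d + 1) \<le> n"
  proof -
    have "real (((2 * b) ^ d)\<^sup>2 * (2 * d + 1)) = (real ((2 * b) ^ d))\<^sup>2 * (2 * real d + 1)"
      by (simp add: distrib_left)
    also have "\<dots> \<le> (exp (L / 6))\<^sup>2 * (2 * L + 1)"
      using m dL by (intro mult_mono power_mono) auto
    also have "(exp (L / 6))\<^sup>2 = exp (L / 3)"
      by (simp flip: exp_double)
    finally have "real (((2 * b) ^ d)\<^sup>2 * (2 * d + 1)) \<le> real n"
      using a5 n by linarith
    then show ?thesis by (simp only: of_nat_le_iff)
  qed
  have n2: "A * d * (2 * b) ^ (d + 1) * (d + 3) \<le> n"
    using Adiv unfolding X_def by (simp only: mult.assoc flip: of_nat_mult of_nat_le_iff[where 'a = real])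
  have n3: "2 * b + A + 2 \<le> n"
  proof -
    have "real A * 8 \<le> real A * real X" using X8 by (intro mult_left_mono) auto
    then have "real A \<le> real n / 8" using Adiv by linarith
    then have "real (2 * b + A + 2) \<le> real n" using a6 b(2) n by simp
    then show ?thesis by (simp only: of_nat_le_iff)
  qed
  have lg: "log 2 (real n) = L / ln 2" by (simp add: log_def L_def)
  have lnn: "1 \<le> log 2 (real n)"
    using ln_le_minus_one[of 2] a10 unfolding lg by (simp add: field_simps)
  have prod1: "1 \<le> real (4 * b * d * (d + 3))"
    using b(3) d1 by (simp add: Suc_le_eq del: of_nat_mult)
  have powr1: "1 \<le> log 2 (real n) powr c"
    using lnn c(1) by (rule ge_one_powr_ge_zero)
  have \<sigma>1: "1 \<le> \<sigma>"
    unfolding \<sigma>_def using mult_mono[OF powr1 prod1] powr1 by simp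
  \<comment> \<open>\<open>2 * X\<close> is \<open>4 * b * d * (d + 3)\<close> times
    \<open>(2 * b) ^ d\<close>, which explains the second factor of \<open>\<sigma>\<close>.\<close>
  have "real n \<le> 2 * (real A * real X)" using Al by simp
  also have "\<dots> = real (4 * b * d * (d + 3)) * real (A * (2 * b) ^ d)"
    unfolding Xr by simp
  finally have "log 2 (real n) powr c * real n
      \<le> log 2 (real n) powr c * (real (4 * b * d * (d + 3)) * real (A * (2 * b) ^ d))"
    by (intro mult_left_mono) auto
  then have \<sigma>2: "real s \<le> \<sigma> * real (A * (2 * b) ^ d)"
    using s unfolding \<sigma>_def by (simp only: mult_ac)
  have core: "real d * ln (real Y) \<le> 6 + 6 * real t * ln \<sigma> + 2 * real t * real w / real Y"
    using butterfly.lcs_ds_probe_bound[OF ds A1 _ _ n1 n2 n3 \<sigma>1 \<sigma>2 Y1] b d1 by simp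
  have ln\<sigma>: "ln \<sigma> \<le> (2 * c + 9) * ln L"
  proof -
    have "ln \<sigma> = c * ln (log 2 (real n)) + ln (real (4 * b * d * (d + 3)))"
      using lnn prod1 unfolding \<sigma>_def by (subst ln_mult) (auto simp: ln_powr simp del: of_nat_mult)
    also have "\<dots> \<le> c * (2 * ln L) + 9 * ln L"
    proof (intro add_mono mult_left_mono c(1))
      have "ln (log 2 (real n)) \<le> ln (L\<^sup>2)"
        using lnn a7 lg by (intro ln_mono) linarith+
      then show "ln (log 2 (real n)) \<le> 2 * ln L"
        using a10 by (simp add: ln_realpow)
      have "real (4 * b * d * (d + 3)) = 4 * real b * real d * (real d + 3)"
        by (simp add: algebra_simps)
      also have "\<dots> \<le> 4 * (L ^ 3 + 1)\<^sup>2 * L * (L + 3)"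
        using b dL a10 by (intro mult_mono) (auto intro!: mult_nonneg_nonneg)
      finally have "ln (real (4 * b * d * (d + 3))) \<le> ln (L ^ 9)"
        using a8 prod1 by (intro ln_mono) linarith+
      then show "ln (real (4 * b * d * (d + 3))) \<le> 9 * ln L"
        using a10 by (simp add: ln_realpow)
    qed
    finally show ?thesis by (simp add: algebra_simps)
  qed
  have wY: "2 * real t * real w / real Y \<le> real t"
  proof -
    have "real w \<le> cw * L\<^sup>2"
      using w a7 c(2) unfolding lg by (meson mult_left_mono order_trans less_imp_le)
    then have "2 * real w \<le> (2 * cw) * L\<^sup>2" by simp
    also have "\<dots> \<le> L * L\<^sup>2" using a9 by (intro mult_right_mono) auto
    also have "\<dots> \<le> real Y" using Yl by (simp add: power3_eq_cube power2_eq_square)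
    finally have "real t * (2 * real w) \<le> real t * real Y" by (intro mult_left_mono) auto
    then show ?thesis using Y1 by (simp add: field_simps)
  qed
  have "3 * L / 49 = L / (49 * ln L) * (3 * ln L)" using a1 by (simp add: field_simps)
  also have "\<dots> \<le> real d * ln (real Y)"
    using dl' lnY a1 by (intro mult_mono) auto
  finally have "3 * L / 49 \<le> 6 + 6 * real t * ln \<sigma> + real t"
    using core wY by linarith
  moreover have "6 * real t * ln \<sigma> \<le> 6 * real t * ((2 * c + 9) * ln L)"
    using ln\<sigma> by (intro mult_left_mono) auto
  moreover have "real t \<le> real t * ln L"
    using mult_left_mono[OF a1, of "real t"] by simp
  moreover have "6 * real t * ((2 * c + 9) * ln L) + real t * ln L = real t * ((12 * c + 55) * ln L)"
    by (simp add: algebra_simps)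
  \<comment> \<open>From \<open>294 \<le> L\<close> the constant 6 is at most \<open>L / 49\<close>;
    and \<open>12 * c + 55\<close> is \<open>6 * (2 * c + 9) + 1\<close>.\<close>
  ultimately have "2 * L / 49 \<le> real t * ((12 * c + 55) * ln L)"
    using a10 by linarith
  moreover have "0 < (12 * c + 55) * ln L"
    using a1 c(1) by (intro mult_pos_pos) auto
  ultimately have "2 * L / 49 / ((12 * c + 55) * ln L) \<le> real t"
    by (simp only: pos_divide_le_eq)
  then show ?thesis
    by (simp add: mult_ac)
qed

theorem theorem27:
  fixes c cw :: real
  assumes "c \<ge> 0" and "cw > 0"
  shows "\<exists>\<epsilon>>0. \<exists>N::nat. \<forall>n\<ge>N. \<forall>s w init upd t.
           lcs_ds n s w init upd t \<longrightarrow>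
           real s \<le> real n * log 2 (real n) powr c \<longrightarrow>
           real w \<le> cw * log 2 (real n) \<longrightarrow>
           real t \<ge> \<epsilon> * ln (real n) / ln (ln (real n))"
proof -
  obtain N where N: "\<And>n. n \<ge> N \<Longrightarrow> 0 < n \<and> sufficiently_large cw (ln (real n))"
    using eventually_conj[OF eventually_gt_at_top[of "0 :: nat"] eventually_sufficiently_large[of cw]]
    unfolding eventually_sequentially by blast
  show ?thesis
  \<comment> \<open>The constant depends on \<open>c\<close> alone; the word-size factor
    \<open>cw\<close> affects only the threshold \<open>N\<close>.\<close>
  proof (rule exI[of _ "2 / (49 * (12 * c + 55))"], intro conjI exI[of _ N] allI impI)
    show "0 < 2 / (49 * (12 * c + 55))" using assms(1) by simp
    fix n s w init upd t
    assume "N \<le> n" "lcs_ds n s w init upd t" "real s \<le> real n * log 2 (real n) powr c"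
      "real w \<le> cw * log 2 (real n)"
    then show "2 / (49 * (12 * c + 55)) * ln (real n) / ln (ln (real n)) \<le> real t"
      using N[of n]
      by (intro lcs_ds_bound_for_large_log[OF assms refl, of n s w init upd t]) simp_all
  qed
qed

end
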